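(* Let $R$ be a commutative ring with identity and let $K$ be a finite abstract simplicial complex with face relation $\leq$. Let $I(R)$ denote the set of ideals of $R$, and view $(I(R),\subseteq)$ as a poset category. Let $\mathcal{I}:(K,\leq)\rightarrow (I(R),\subseteq)$ be any functor, $\sigma\mapsto\mathcal{I}_\sigma$. Set $\mathcal{O}_\sigma = R/\mathcal{I}_\sigma$ for each $\sigma\in K$, and for $\sigma\leq\tau$ in $K$ let $\mathcal{O}_{\sigma,\tau}: R/\mathcal{I}_\sigma\rightarrow R/\mathcal{I}_\tau$ be the canonical ring homomorphism $\overline{x}\mapsto\overline{x}$ (sending the class of $x \in R$ modulo $\mathcal{I}_\sigma$ to the class of $x$ modulo $\mathcal{I}_\tau$). Then these data are well defined and form a cellular sheaf of rings $\mathcal{O}:(K,\leq)\rightarrow \mathsf{Ring}$ on $K$.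
   Context: A simplicial complex $K$ on a finite vertex set $V=\{1,\dots,n\}$ is a collection of non-empty subsets of $V$ (simplices), containing every singleton, such that every non-empty subset of a member of $K$ is again in $K$. The face relation is $\sigma\leq\tau$ iff $\sigma\subseteq\tau$, so $(K,\leq)$ is a poset, regarded as a category with one morphism $\sigma\to\tau$ whenever $\sigma\leq\tau$. $\mathsf{Ring}$ is the category of commutative rings with identity and identity-preserving ring homomorphisms. A cellular sheaf of rings on $K$ is a covariant functor $\mathcal{O}:(K,\leq)\to\mathsf{Ring}$: it assigns to each $\sigma\in K$ a ring $\mathcal{O}_\sigma$ and to each face relation $\sigma\leq\tau$ a ring homomorphism $\mathcal{O}_{\sigma,\tau}:\mathcal{O}_\sigma\to\mathcal{O}_\tau$, with $\mathcal{O}_{\sigma,\sigma}=\mathrm{id}$ and $\mathcal{O}_{\tau,\rho}\circ\mathcal{O}_{\sigma,\tau}=\mathcal{O}_{\sigma,\rho}$ whenever $\sigma\leq\tau\leq\rho$. A functor $(K,\leq)\to(I(R),\subseteq)$ is the same as an order-preserving map, i.e. $\mathcal{I}_\sigma\subseteq\mathcal{I}_\tau$ whenever $\sigma\leq\tau$. *)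

theory Defs
  imports "HOL-Algebra.QuotRing"
begin

locale abstract_simplicial_complex =
  fixes V :: "'v set" and K :: "'v set set"
  assumes finite_vertices: "finite V"
    and simplex_nonempty: "\<sigma> \<in> K \<Longrightarrow> \<sigma> \<noteq> {}"
    and simplex_subset: "\<sigma> \<in> K \<Longrightarrow> \<sigma> \<subseteq> V"
    and singleton_simplex: "v \<in> V \<Longrightarrow> {v} \<in> K"
    and face_closed: "\<tau> \<in> K \<Longrightarrow> \<sigma> \<subseteq> \<tau> \<Longrightarrow> \<sigma> \<noteq> {} \<Longrightarrow> \<sigma> \<in> K"

text \<open>
  A covariant functor from the face poset of \<open>K\<close> to commutative rings. All stalks have their
  elements in one type; ring homomorphisms are total functions of which only the values on the
  carrier matter, so the functor laws are equations on carriers.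
\<close>

locale cellular_sheaf = abstract_simplicial_complex V K
  for V :: "'v set" and K :: "'v set set" +
  fixes stalk :: "'v set \<Rightarrow> ('a, 'm) ring_scheme"
    and res :: "'v set \<Rightarrow> 'v set \<Rightarrow> 'a \<Rightarrow> 'a"
  assumes stalk_cring: "\<sigma> \<in> K \<Longrightarrow> cring (stalk \<sigma>)"
    and res_hom: "\<sigma> \<in> K \<Longrightarrow> \<tau> \<in> K \<Longrightarrow> \<sigma> \<subseteq> \<tau> \<Longrightarrow> res \<sigma> \<tau> \<in> ring_hom (stalk \<sigma>) (stalk \<tau>)"
    and res_id: "\<sigma> \<in> K \<Longrightarrow> a \<in> carrier (stalk \<sigma>) \<Longrightarrow> res \<sigma> \<sigma> a = a"
    and res_comp: "\<sigma> \<in> K \<Longrightarrow> \<tau> \<in> K \<Longrightarrow> \<rho> \<in> K \<Longrightarrow> \<sigma> \<subseteq> \<tau> \<Longrightarrow> \<tau> \<subseteq> \<rho> \<Longrightarrow>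
      a \<in> carrier (stalk \<sigma>) \<Longrightarrow> res \<tau> \<rho> (res \<sigma> \<tau> a) = res \<sigma> \<rho> a"

text \<open>
  The assignment \<open>I + x \<mapsto> J + x\<close> on cosets. The description is meaningful only if \<open>J + x\<close> does not
  depend on the representative \<open>x\<close> of the coset; otherwise the value is unspecified.
\<close>

definition quot_map :: "('a, 'm) ring_scheme \<Rightarrow> 'a set \<Rightarrow> 'a set \<Rightarrow> 'a set \<Rightarrow> 'a set"
  where "quot_map R I J A =
    (THE B. \<exists>x\<in>carrier R. A = I +>\<^bsub>R\<^esub> x \<and> B = J +>\<^bsub>R\<^esub> x)"

end

theory Submission
  imports Defs
begin

text \<open>If I \<subseteq> J, then J contains the kernel of the projection R -> R/I, so the
  projection R -> R/J factors through R/I; the factor is \<open>quot_map R I J\<close>. Lemma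
  \<open>a_rcos_eq_mono\<close> is the independence of representatives, and
  \<open>quot_map_rcos\<close> turns it into the computation rule I + x -> J + x. Every element of a
  quotient is the class of some x in R, so the homomorphism and functor laws need checking only on
  classes, where that rule reduces both sides to the same coset.\<close>

lemma a_rcos_eq_mono:
  assumes I: "ideal I R" and J: "ideal J R" and sub: "I \<subseteq> J"
    and x: "x \<in> carrier R" and y: "y \<in> carrier R"
    and eq: "I +>\<^bsub>R\<^esub> x = I +>\<^bsub>R\<^esub> y"
  shows "J +>\<^bsub>R\<^esub> x = J +>\<^bsub>R\<^esub> y"
proof -
  interpret I: ideal I R by fact
  interpret J: ideal J R by fact
  \<comment> \<open>Comparing cosets through membership makes the inclusion usable: I + y is
    contained in J + y, and a coset of J is determined by any one of its elements.\<close>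
  have "x \<in> I +>\<^bsub>R\<^esub> y"
    using I.a_rcos_self[OF x] eq by simp
  then have "x \<in> J +>\<^bsub>R\<^esub> y"
    using sub by (auto simp: a_r_coset_def')
  then show ?thesis
    using J.a_repr_independence' y by simp
qed

text \<open>The definite description denotes because all representatives of I + x yield the same
  coset of J. From here on this equation replaces the definition.\<close>

lemma quot_map_rcos:
  assumes "ideal I R" "ideal J R" "I \<subseteq> J" "x \<in> carrier R"
  shows "quot_map R I J (I +>\<^bsub>R\<^esub> x) = J +>\<^bsub>R\<^esub> x"
  unfolding quot_map_def
proof (rule the_equality)
  show "\<exists>y\<in>carrier R. I +>\<^bsub>R\<^esub> x = I +>\<^bsub>R\<^esub> y \<and> J +>\<^bsub>R\<^esub> x = J +>\<^bsub>R\<^esub> y"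
    using assms(4) by blast
  show "B = J +>\<^bsub>R\<^esub> x"
    if "\<exists>y\<in>carrier R. I +>\<^bsub>R\<^esub> x = I +>\<^bsub>R\<^esub> y \<and> B = J +>\<^bsub>R\<^esub> y" for B
    using that a_rcos_eq_mono[OF assms] by metis
qed

text \<open>Surjectivity of the projection, in a form from which representatives can be
  extracted.\<close>

lemma carrier_Quot: "carrier (R Quot I) = (+>\<^bsub>R\<^esub>) I ` carrier R"
  by (auto simp: FactRing_def A_RCOSETS_def')

text \<open>Composing \<open>quot_map R I J\<close> with the projection to R/I gives the projection
  to R/J. Both projections are homomorphisms and the first is onto, so the map between them is a
  homomorphism too.\<close>

lemma quot_map_ring_hom:
  assumes I: "ideal I R" and J: "ideal J R" and sub: "I \<subseteq> J"
  shows "quot_map R I J \<in> ring_hom (R Quot I) (R Quot J)"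
proof -
  interpret I: ideal I R by fact
  interpret J: ideal J R by fact
  note quot_map_rcos = quot_map_rcos[OF I J sub]
  note I_hom = I.rcos_ring_hom and J_hom = J.rcos_ring_hom
  show ?thesis
  proof (rule ring_hom_memI)
    fix A assume "A \<in> carrier (R Quot I)"
    then show "quot_map R I J A \<in> carrier (R Quot J)"
      by (auto simp: carrier_Quot quot_map_rcos)
  next
    fix A B assume "A \<in> carrier (R Quot I)" "B \<in> carrier (R Quot I)"
    then obtain x y where xy: "x \<in> carrier R" "y \<in> carrier R"
      and AB: "A = I +>\<^bsub>R\<^esub> x" "B = I +>\<^bsub>R\<^esub> y"
      by (auto simp: carrier_Quot)
    show "quot_map R I J (A \<otimes>\<^bsub>R Quot I\<^esub> B) = quot_map R I J A \<otimes>\<^bsub>R Quot J\<^esub> quot_map R I J B"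
      \<comment> \<open>Read from right to left, the projection laws merge a product of two cosets
        into the coset of a product, to which \<open>quot_map_rcos\<close> applies.\<close>
      by (simp add: AB xy quot_map_rcos flip: ring_hom_mult[OF I_hom] ring_hom_mult[OF J_hom])
    show "quot_map R I J (A \<oplus>\<^bsub>R Quot I\<^esub> B) = quot_map R I J A \<oplus>\<^bsub>R Quot J\<^esub> quot_map R I J B"
      by (simp add: AB xy quot_map_rcos flip: ring_hom_add[OF I_hom] ring_hom_add[OF J_hom])
  next
    show "quot_map R I J \<one>\<^bsub>R Quot I\<^esub> = \<one>\<^bsub>R Quot J\<^esub>"
      by (simp add: quot_map_rcos flip: ring_hom_one[OF I_hom] ring_hom_one[OF J_hom])
  qed
qed

theorem proposition2:
  fixes R :: "('a, 'm) ring_scheme"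
    and V :: "'v set" and K :: "'v set set"
    and I :: "'v set \<Rightarrow> 'a set"
  assumes "cring R"
    and "abstract_simplicial_complex V K"
    and "\<forall>\<sigma>\<in>K. ideal (I \<sigma>) R"
    and "\<forall>\<sigma>\<in>K. \<forall>\<tau>\<in>K. \<sigma> \<subseteq> \<tau> \<longrightarrow> I \<sigma> \<subseteq> I \<tau>"
  shows "(\<forall>\<sigma>\<in>K. \<forall>\<tau>\<in>K. \<sigma> \<subseteq> \<tau> \<longrightarrow>
            (\<forall>x\<in>carrier R. \<forall>y\<in>carrier R.
               I \<sigma> +>\<^bsub>R\<^esub> x = I \<sigma> +>\<^bsub>R\<^esub> y \<longrightarrow> I \<tau> +>\<^bsub>R\<^esub> x = I \<tau> +>\<^bsub>R\<^esub> y)) \<and>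
         (\<forall>\<sigma>\<in>K. \<forall>\<tau>\<in>K. \<sigma> \<subseteq> \<tau> \<longrightarrow>
            (\<forall>x\<in>carrier R. quot_map R (I \<sigma>) (I \<tau>) (I \<sigma> +>\<^bsub>R\<^esub> x) = I \<tau> +>\<^bsub>R\<^esub> x)) \<and>
         cellular_sheaf V K (\<lambda>\<sigma>. R Quot I \<sigma>) (\<lambda>\<sigma> \<tau>. quot_map R (I \<sigma>) (I \<tau>))"
proof (intro conjI)
  have ideal: "ideal (I \<sigma>) R" if "\<sigma> \<in> K" for \<sigma>
    using assms(3) that by blast
  have mono: "I \<sigma> \<subseteq> I \<tau>" if "\<sigma> \<in> K" "\<tau> \<in> K" "\<sigma> \<subseteq> \<tau>" for \<sigma> \<tau>
    using assms(4) that by blast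
  show "\<forall>\<sigma>\<in>K. \<forall>\<tau>\<in>K. \<sigma> \<subseteq> \<tau> \<longrightarrow>
      (\<forall>x\<in>carrier R. \<forall>y\<in>carrier R.
         I \<sigma> +>\<^bsub>R\<^esub> x = I \<sigma> +>\<^bsub>R\<^esub> y \<longrightarrow> I \<tau> +>\<^bsub>R\<^esub> x = I \<tau> +>\<^bsub>R\<^esub> y)"
    by (intro ballI impI) (rule a_rcos_eq_mono[OF ideal ideal mono])
  show "\<forall>\<sigma>\<in>K. \<forall>\<tau>\<in>K. \<sigma> \<subseteq> \<tau> \<longrightarrow>
      (\<forall>x\<in>carrier R. quot_map R (I \<sigma>) (I \<tau>) (I \<sigma> +>\<^bsub>R\<^esub> x) = I \<tau> +>\<^bsub>R\<^esub> x)"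
    by (simp add: quot_map_rcos ideal mono)
  show "cellular_sheaf V K (\<lambda>\<sigma>. R Quot I \<sigma>) (\<lambda>\<sigma> \<tau>. quot_map R (I \<sigma>) (I \<tau>))"
  proof (intro cellular_sheaf.intro cellular_sheaf_axioms.intro)
    show "abstract_simplicial_complex V K" by fact
  next
    fix \<sigma> assume "\<sigma> \<in> K"
    then show "cring (R Quot I \<sigma>)"
      using ideal.quotient_is_cring[OF ideal] assms(1) by blast
  next
    fix \<sigma> \<tau> assume "\<sigma> \<in> K" "\<tau> \<in> K" "\<sigma> \<subseteq> \<tau>"
    then show "quot_map R (I \<sigma>) (I \<tau>) \<in> ring_hom (R Quot I \<sigma>) (R Quot I \<tau>)"
      by (intro quot_map_ring_hom ideal mono)
  next
    fix \<sigma> A assume "\<sigma> \<in> K" "A \<in> carrier (R Quot I \<sigma>)"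
    then show "quot_map R (I \<sigma>) (I \<sigma>) A = A"
      by (auto simp: carrier_Quot quot_map_rcos ideal)
  next
    fix \<sigma> \<tau> \<rho> A
    assume K: "\<sigma> \<in> K" "\<tau> \<in> K" "\<rho> \<in> K" and sub: "\<sigma> \<subseteq> \<tau>" "\<tau> \<subseteq> \<rho>"
      and "A \<in> carrier (R Quot I \<sigma>)"
    then obtain x where "x \<in> carrier R" "A = I \<sigma> +>\<^bsub>R\<^esub> x"
      by (auto simp: carrier_Quot)
    \<comment> \<open>Needed to evaluate the direct map from \<sigma> to \<rho> on the class of x;
      both sides then become \<open>I \<rho> +> x\<close>.\<close>
    moreover have "\<sigma> \<subseteq> \<rho>" using sub by blast
    ultimately show "quot_map R (I \<tau>) (I \<rho>) (quot_map R (I \<sigma>) (I \<tau>) A) = quot_map R (I \<sigma>) (I \<rho>) A"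
      using K sub by (simp add: quot_map_rcos ideal mono)
  qed
qed

end
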